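(* Let $r(t)$ be a twice differentiable parametrized curve in $\mathbb{R}^3$ with constant velocity $\|\dot r(t)\|=1$ and curvature $$K(t)=\frac{\|\dot r(t)\wedge\ddot r(t)\|}{\|\dot r(t)\|^3}=\|\dot r(t)\wedge\ddot r(t)\|,$$ where $\wedge$ denotes the vector cross product in $\mathbb{R}^3$. Let $R$ denote the rotation of angle $\pi/3$ of the vector plane generated by $\dot r(t)$ and $\ddot r(t)$, oriented from $\ddot r(t)$ to $\dot r(t)$; if $\dot r(t)$ and $\ddot r(t)$ are collinear, let $R$ be the rotation of angle $\pi/3$ of any vector plane containing $\ddot r(t)$, with any orientation. Then, for every $t$, $$2\sqrt{3}\,K(t)=1+\|\ddot r(t)\|^2+\|\dot r(t)-\ddot r(t)\|^2-2\|\dot r(t)-R(\ddot r(t))\|^2\le 1+\|\ddot r(t)\|^2+\|\dot r(t)-\ddot r(t)\|^2,$$ with equality in the inequality if $\|\ddot r(t)\|=\|\dot r(t)-\ddot r(t)\|=1$.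
   Context: $\mathbb{R}^3$ carries its standard inner product and Euclidean norm $\|\cdot\|$; dots denote derivatives with respect to $t$. Orienting the plane generated by linearly independent vectors from $\ddot r(t)$ to $\dot r(t)$ means that $(\ddot r(t),\dot r(t))$ is a positively oriented basis. The rotation of angle $\pi/3$ of an oriented plane is the linear map with $R(e_1)=\frac12 e_1+\frac{\sqrt3}{2}e_2$ and $R(e_2)=-\frac{\sqrt3}{2}e_1+\frac12 e_2$ for any positively oriented orthonormal basis $(e_1,e_2)$. The rotation $R$ depends on $t$. *)

theory Defs
  imports "HOL-Analysis.Analysis"
begin

text \<open>Derivatives are taken within the parameter interval, so one-sided derivatives are meant
  at endpoints of the interval that belong to it.\<close>

definition velocity :: "real set \<Rightarrow> (real \<Rightarrow> real^3) \<Rightarrow> real \<Rightarrow> real^3"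
  where "velocity I r t = vector_derivative r (at t within I)"

definition acceleration :: "real set \<Rightarrow> (real \<Rightarrow> real^3) \<Rightarrow> real \<Rightarrow> real^3"
  where "acceleration I r = velocity I (velocity I r)"

definition twice_differentiable_on :: "(real \<Rightarrow> real^3) \<Rightarrow> real set \<Rightarrow> bool"
  where "twice_differentiable_on r I \<longleftrightarrow>
    r differentiable_on I \<and> velocity I r differentiable_on I"

definition curvature :: "real set \<Rightarrow> (real \<Rightarrow> real^3) \<Rightarrow> real \<Rightarrow> real"
  where "curvature I r t =
    norm (cross3 (velocity I r t) (acceleration I r t)) / norm (velocity I r t) ^ 3"

definition linearly_independent_pair :: "real^3 \<Rightarrow> real^3 \<Rightarrow> bool"
  where "linearly_independent_pair b1 b2 \<longleftrightarrow> b1 \<noteq> b2 \<and> independent {b1, b2}"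

text \<open>A linearly independent pair \<open>(b1, b2)\<close> represents the vector plane \<open>span {b1, b2}\<close>
  with the orientation for which \<open>(b1, b2)\<close> is positively oriented. Another pair is a positively
  oriented basis of this plane iff its coordinate matrix with respect to \<open>(b1, b2)\<close> has positive
  determinant.\<close>

definition positively_oriented_basis :: "real^3 \<Rightarrow> real^3 \<Rightarrow> real^3 \<Rightarrow> real^3 \<Rightarrow> bool"
  where "positively_oriented_basis b1 b2 e1 e2 \<longleftrightarrow>
    (\<exists>p q s u. e1 = p *\<^sub>R b1 + q *\<^sub>R b2 \<and> e2 = s *\<^sub>R b1 + u *\<^sub>R b2 \<and> p * u - q * s > 0)"

text \<open>\<open>R\<close> is the rotation of angle \<open>\<theta>\<close> of the plane represented by \<open>(b1, b2)\<close>. Only the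
  restriction of \<open>R\<close> to the plane matters; its values elsewhere are arbitrary.\<close>

definition plane_rotation :: "real^3 \<Rightarrow> real^3 \<Rightarrow> real \<Rightarrow> (real^3 \<Rightarrow> real^3) \<Rightarrow> bool"
  where "plane_rotation b1 b2 \<theta> R \<longleftrightarrow>
    (\<forall>x\<in>span {b1, b2}. \<forall>y\<in>span {b1, b2}. R (x + y) = R x + R y) \<and>
    (\<forall>c. \<forall>x\<in>span {b1, b2}. R (c *\<^sub>R x) = c *\<^sub>R R x) \<and>
    (\<forall>e1 e2. positively_oriented_basis b1 b2 e1 e2 \<and> norm e1 = 1 \<and> norm e2 = 1 \<and> e1 \<bullet> e2 = 0 \<longrightarrow>
      R e1 = cos \<theta> *\<^sub>R e1 + sin \<theta> *\<^sub>R e2 \<and>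
      R e2 = - sin \<theta> *\<^sub>R e1 + cos \<theta> *\<^sub>R e2)"

end

theory Submission
  imports Defs
begin

text \<open>
  Differentiating \<open>v \<bullet> v = 1\<close> shows that the velocity \<open>v\<close> and the acceleration \<open>a\<close> are orthogonal,
  so the curvature is \<open>norm a\<close>. If \<open>a \<noteq> 0\<close>, then \<open>(a / norm a, v)\<close> is a positively oriented
  orthonormal basis of the osculating plane, and therefore
  \<open>R a = a / 2 + (sqrt 3 / 2) * norm a * v\<close>. If \<open>a\<close> and \<open>v\<close> are collinear, orthogonality forces
  \<open>a = 0\<close>, and the same formula reads \<open>R 0 = 0\<close>, whichever plane and orientation \<open>R\<close> belongs to.
  The identity is then Pythagoras' theorem:
  \<open>norm (v - R a) ^ 2 = 1 + norm a ^ 2 - sqrt 3 * norm a\<close> and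
  \<open>norm (v - a) ^ 2 = 1 + norm a ^ 2\<close>.

  The inequality only drops a square. For unit \<open>v\<close> and \<open>a\<close>, the condition \<open>norm (v - a) = 1\<close> says
  that \<open>v\<close>, \<open>a\<close> and \<open>0\<close> form an equilateral triangle, which is what would give \<open>R a = v\<close>. Along a
  curve of unit speed, however, the triangle is right-angled at \<open>0\<close>, so \<open>norm (v - a) ^ 2 = 2\<close>
  when \<open>norm a = 1\<close>: the equilateral case does not occur, and the equality clause holds vacuously.
\<close>

lemma unit_norm_orthogonal_derivative:
  fixes f :: "real \<Rightarrow> 'a::real_inner"
  assumes deriv: "(f has_vector_derivative f') (at t within I)"
    and unit: "\<And>s. s \<in> I \<Longrightarrow> norm (f s) = 1"
    and t: "t \<in> I" "at t within I \<noteq> bot"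
  shows "f t \<bullet> f' = 0"
proof -
  have "((\<lambda>s. f s \<bullet> f s) has_derivative (\<lambda>h. f t \<bullet> (h *\<^sub>R f') + (h *\<^sub>R f') \<bullet> f t)) (at t within I)"
    using deriv unfolding has_vector_derivative_def by (intro has_derivative_inner)
  then have "((\<lambda>s. f s \<bullet> f s) has_vector_derivative 2 * (f t \<bullet> f')) (at t within I)"
    unfolding has_vector_derivative_def
    by (simp add: inner_commute algebra_simps)
  moreover have "((\<lambda>s. f s \<bullet> f s) has_vector_derivative 0) (at t within I)"
  proof (rule has_vector_derivative_transform)
    show "((\<lambda>s. 1) has_vector_derivative 0) (at t within I)"
      by (rule has_vector_derivative_const)
  qed (use t unit in \<open>auto simp: dot_square_norm\<close>)
  ultimately show ?thesis
    using vector_derivative_unique_within[OF t(2)] by fastforce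
qed

text \<open>This makes derivatives within the interval unique, also at its endpoints.\<close>

lemma interval_at_within_nontrivial:
  fixes I :: "real set"
  assumes "is_interval I" "interior I \<noteq> {}" "t \<in> I"
  shows "at t within I \<noteq> bot"
proof -
  obtain s where "s \<in> interior I" using assms(2) by blast
  then have "I \<noteq> {t}" by auto
  then have "t islimpt I"
    using assms(1,3) by (intro connected_imp_perfect) (auto simp: is_interval_connected)
  then show ?thesis by (simp add: trivial_limit_within)
qed

lemma velocity_orthogonal_acceleration:
  assumes "is_interval I" "interior I \<noteq> {}" "twice_differentiable_on r I"
    and "\<And>s. s \<in> I \<Longrightarrow> norm (velocity I r s) = 1" "t \<in> I"
  shows "velocity I r t \<bullet> acceleration I r t = 0"
proof (rule unit_norm_orthogonal_derivative)
  show "(velocity I r has_vector_derivative acceleration I r t) (at t within I)"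
    unfolding acceleration_def velocity_def[of I "velocity I r"]
    using assms(3,5)
    by (auto simp: twice_differentiable_on_def differentiable_on_def vector_derivative_works)
qed (use assms interval_at_within_nontrivial in auto)

text \<open>Up to scaling, \<open>(a, v)\<close> is itself a positively oriented orthonormal basis, so the defining
  property of the rotation applies to it directly.\<close>

lemma plane_rotation_first_axis:
  assumes "plane_rotation a v \<theta> R" "a \<noteq> 0" "norm v = 1" "v \<bullet> a = 0"
  shows "R a = cos \<theta> *\<^sub>R a + (norm a * sin \<theta>) *\<^sub>R v"
proof -
  define e where "e = a /\<^sub>R norm a"
  have a: "a = norm a *\<^sub>R e" using assms(2) by (simp add: e_def)
  have "positively_oriented_basis a v e v"
    unfolding positively_oriented_basis_def e_def using assms(2)
    by (intro exI[of _ "inverse (norm a)"] exI[of _ 0] exI[of _ 1]) auto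
  moreover have "norm e = 1" "e \<bullet> v = 0"
    using assms(2,4) by (auto simp: e_def inner_commute)
  ultimately have "R e = cos \<theta> *\<^sub>R e + sin \<theta> *\<^sub>R v"
    using assms(1,3) unfolding plane_rotation_def by blast
  moreover have "e \<in> span {a, v}"
    by (simp add: e_def span_base span_scale)
  then have "R (norm a *\<^sub>R e) = norm a *\<^sub>R R e"
    using assms(1) unfolding plane_rotation_def by blast
  ultimately show ?thesis
    using a by (metis scaleR_add_right scaleR_scaleR mult.commute)
qed

lemma plane_rotation_zero:
  assumes "plane_rotation b1 b2 \<theta> R"
  shows "R 0 = 0"
proof -
  have "R (0 *\<^sub>R 0) = 0 *\<^sub>R R 0"
    using assms span_zero unfolding plane_rotation_def by blast
  then show ?thesis by simp
qed

lemma orthogonal_linearly_independent_pair: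
  assumes "a \<noteq> 0" "norm v = 1" "v \<bullet> a = 0"
  shows "linearly_independent_pair a v"
  unfolding linearly_independent_pair_def
proof
  show "a \<noteq> v" using assms by auto
  have "pairwise orthogonal {a, v}"
    using assms(3) by (auto simp: pairwise_insert orthogonal_def inner_commute)
  then show "independent {a, v}"
    using assms by (intro pairwise_orthogonal_independent) auto
qed

lemma norm_cross3_orthogonal:
  assumes "x \<bullet> y = 0"
  shows "norm (cross3 x y) = norm x * norm y"
proof -
  have "(norm (cross3 x y))\<^sup>2 = (norm x * norm y)\<^sup>2"
    using norm_cross_dot[of x y] assms by simp
  then show ?thesis by simp
qed

text \<open>Here \<open>w\<close> is the image of \<open>a\<close> under the rotation of angle \<open>pi / 3\<close> towards \<open>v\<close>.\<close>

lemma norm_diff_rotated_squared: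
  fixes a v :: "'a::real_inner"
  assumes "norm v = 1" "v \<bullet> a = 0"
    and w: "w = (1/2) *\<^sub>R a + (norm a * (sqrt 3 / 2)) *\<^sub>R v"
  shows "(norm (v - w))\<^sup>2 = 1 + (norm a)\<^sup>2 - sqrt 3 * norm a"
proof -
  let ?c = "1 - norm a * (sqrt 3 / 2)"
  have "v - w = ?c *\<^sub>R v + (- 1/2) *\<^sub>R a"
    by (simp add: w algebra_simps)
  moreover have "orthogonal (?c *\<^sub>R v) ((- 1/2) *\<^sub>R a)"
    using assms(2) by (simp add: orthogonal_def)
  ultimately have "(norm (v - w))\<^sup>2 = (norm (?c *\<^sub>R v))\<^sup>2 + (norm ((- 1/2) *\<^sub>R a))\<^sup>2"
    by (metis norm_add_Pythagorean)
  also have "\<dots> = ?c\<^sup>2 + (norm a)\<^sup>2 / 4"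
    using assms(1) by (simp add: power_mult_distrib power_divide)
  also have "\<dots> = 1 + (norm a)\<^sup>2 - sqrt 3 * norm a"
    by (simp add: power2_diff power_mult_distrib power_divide)
  finally show ?thesis .
qed

theorem theorem2p2:
  fixes r :: "real \<Rightarrow> real^3" and I :: "real set" and R :: "real \<Rightarrow> real^3 \<Rightarrow> real^3"
  assumes interval: "is_interval I" "interior I \<noteq> {}"
    and twice_diff: "twice_differentiable_on r I"
    and unit_speed: "\<And>t. t \<in> I \<Longrightarrow> norm (velocity I r t) = 1"
    and rotation:
      "\<And>t. t \<in> I \<Longrightarrow> linearly_independent_pair (acceleration I r t) (velocity I r t) \<Longrightarrow>
        plane_rotation (acceleration I r t) (velocity I r t) (pi / 3) (R t)"
    and rotation_collinear:
      "\<And>t. t \<in> I \<Longrightarrow> \<not> linearly_independent_pair (acceleration I r t) (velocity I r t) \<Longrightarrow>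
        \<exists>b1 b2. linearly_independent_pair b1 b2 \<and> acceleration I r t \<in> span {b1, b2} \<and>
          plane_rotation b1 b2 (pi / 3) (R t)"
  shows "\<forall>t\<in>I.
      curvature I r t = norm (cross3 (velocity I r t) (acceleration I r t)) \<and>
      2 * sqrt 3 * curvature I r t =
        1 + (norm (acceleration I r t))\<^sup>2 + (norm (velocity I r t - acceleration I r t))\<^sup>2
          - 2 * (norm (velocity I r t - R t (acceleration I r t)))\<^sup>2 \<and>
      1 + (norm (acceleration I r t))\<^sup>2 + (norm (velocity I r t - acceleration I r t))\<^sup>2
          - 2 * (norm (velocity I r t - R t (acceleration I r t)))\<^sup>2
        \<le> 1 + (norm (acceleration I r t))\<^sup>2 + (norm (velocity I r t - acceleration I r t))\<^sup>2 \<and>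
      (norm (acceleration I r t) = 1 \<and> norm (velocity I r t - acceleration I r t) = 1 \<longrightarrow>
        1 + (norm (acceleration I r t))\<^sup>2 + (norm (velocity I r t - acceleration I r t))\<^sup>2
          - 2 * (norm (velocity I r t - R t (acceleration I r t)))\<^sup>2
        = 1 + (norm (acceleration I r t))\<^sup>2 + (norm (velocity I r t - acceleration I r t))\<^sup>2)"
proof
  fix t assume t: "t \<in> I"
  define v where "v = velocity I r t"
  define a where "a = acceleration I r t"
  have v: "norm v = 1" using unit_speed[OF t] by (simp add: v_def)
  have orth: "v \<bullet> a = 0"
    using velocity_orthogonal_acceleration[OF interval twice_diff unit_speed t]
    by (simp add: v_def a_def)
  have Ra: "R t a = (1/2) *\<^sub>R a + (norm a * (sqrt 3 / 2)) *\<^sub>R v"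
  proof (cases "a = 0")
    case True
    then have "\<not> linearly_independent_pair a v"
      by (auto simp: linearly_independent_pair_def dependent_zero)
    then obtain b1 b2 where "plane_rotation b1 b2 (pi / 3) (R t)"
      using rotation_collinear[OF t] by (auto simp: v_def a_def)
    then show ?thesis using True by (simp add: plane_rotation_zero)
  next
    case False
    then have "plane_rotation a v (pi / 3) (R t)"
      using rotation[OF t] orthogonal_linearly_independent_pair[OF False v orth]
      by (simp add: v_def a_def)
    from plane_rotation_first_axis[OF this False v orth] show ?thesis
      by (simp add: cos_60 sin_60)
  qed
  have K: "curvature I r t = norm (cross3 v a)" "norm (cross3 v a) = norm a"
    using v norm_cross3_orthogonal[OF orth]
    by (simp_all add: curvature_def v_def a_def)
  have diff: "(norm (v - a))\<^sup>2 = 1 + (norm a)\<^sup>2"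
    using norm_add_Pythagorean[of v "- a"] orth v by (simp add: orthogonal_def)
  have no_equilateral: "\<not> (norm a = 1 \<and> norm (v - a) = 1)"
    using diff by auto
  have identity: "2 * sqrt 3 * norm (cross3 v a) =
      1 + (norm a)\<^sup>2 + (norm (v - a))\<^sup>2 - 2 * (norm (v - R t a))\<^sup>2"
    using K(2) diff norm_diff_rotated_squared[OF v orth Ra] by simp
  show "curvature I r t = norm (cross3 (velocity I r t) (acceleration I r t)) \<and>
      2 * sqrt 3 * curvature I r t =
        1 + (norm (acceleration I r t))\<^sup>2 + (norm (velocity I r t - acceleration I r t))\<^sup>2
          - 2 * (norm (velocity I r t - R t (acceleration I r t)))\<^sup>2 \<and>
      1 + (norm (acceleration I r t))\<^sup>2 + (norm (velocity I r t - acceleration I r t))\<^sup>2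
          - 2 * (norm (velocity I r t - R t (acceleration I r t)))\<^sup>2
        \<le> 1 + (norm (acceleration I r t))\<^sup>2 + (norm (velocity I r t - acceleration I r t))\<^sup>2 \<and>
      (norm (acceleration I r t) = 1 \<and> norm (velocity I r t - acceleration I r t) = 1 \<longrightarrow>
        1 + (norm (acceleration I r t))\<^sup>2 + (norm (velocity I r t - acceleration I r t))\<^sup>2
          - 2 * (norm (velocity I r t - R t (acceleration I r t)))\<^sup>2
        = 1 + (norm (acceleration I r t))\<^sup>2 + (norm (velocity I r t - acceleration I r t))\<^sup>2)"
    unfolding v_def[symmetric] a_def[symmetric]
    using K(1) identity no_equilateral by auto
qed

end
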